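(* Let $(\underline P,\overline P)$ be a Vertical Barrier Model on $\mathcal A(\mathbb P)$ built from a probability $P_0$, and let $\mathcal B\subset\mathcal A(\mathbb P)\setminus\{\emptyset\}$ be a partition (finite or infinite) that strictly dilates $A\in\mathcal A(\mathbb P)$. Then the extent of dilation is $$\Delta(A,\mathcal B)=\underline P(A)-\overline P(A)+\min\left\{1,\ \overline E(A|B^* )-\underline E(A|B^* ),\ \frac{1}{1+M_0},\ \frac{1}{1+M_1}\right\},$$ where $B^*\in\mathcal B_A^+$ is such that $P_0(B^* )=\max_{B\in\mathcal B_A^+}P_0(B)$, and $$M_0=\sup_{B\in\mathcal B_A^0}\frac{\underline P(A^{\mathsf c}\wedge B)}{\overline P(A\wedge B)},\qquad M_1=\sup_{B\in\mathcal B_A^1}\frac{\underline P(A\wedge B)}{\overline P(A^{\mathsf c}\wedge B)}.$$ If any of $\mathcal B_A^+$, $\mathcal B_A^0$, $\mathcal B_A^1$ is empty, the corresponding term in the minimum (respectively the one with $B^*$, $M_0$, $M_1$) is omitted.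
   Context: Let $\mathbb P$ be a partition (finite or infinite) of the sure event $\Omega$ and $\mathcal A(\mathbb P)$ the set of events logically dependent on $\mathbb P$, i.e. (identifying events with sets) the power set of $\mathbb P$, with $\Omega$ the whole set, $\emptyset$ the impossible event, $\wedge,{}^{\mathsf c}$ intersection and complement. A partition $\mathcal B\subset\mathcal A(\mathbb P)\setminus\{\emptyset\}$ is a family of pairwise disjoint non-empty events whose union is $\Omega$. "Probability" means finitely additive probability on $\mathcal A(\mathbb P)$. Vertical Barrier Model (VBM): given a probability $P_0$ on $\mathcal A(\mathbb P)$ and $b>0$, $a\le 0$ with $0\le a+b\le 1$, and $c=1-(a+b)$, put $\underline P(A)=\max\{bP_0(A)+a,0\}$ for $A\ne\Omega$, $\underline P(\Omega)=1$; $\overline P(A)=\min\{bP_0(A)+c,1\}$ for $A\ne\emptyset$, $\overline P(\emptyset)=0$. Natural extension: let $\mathcal M=\{P \text{ probability on }\mathcal A(\mathbb P): P\ge\underline P\}$. For $B\ne\emptyset$, let $\mathcal M_B$ be the set of pairs $(P,P(\cdot|B))$ with $P\in\mathcal M$ and $P(\cdot|B)$ a probability on $\mathcal A(\mathbb P)$ satisfying $P(B|B)=1$ and $P(A\wedge B)=P(A|B)P(B)$ for all $A\in\mathcal A(\mathbb P)$. Then $\underline E(A|B)=\inf_{\mathcal M_B}P(A|B)$ and $\overline E(A|B)=\sup_{\mathcal M_B}P(A|B)$. $\mathcal B$ strictly dilates $A$ if $\underline E(A|B)<\underline P(A)\le\overline P(A)<\overline E(A|B)$ for all $B\in\mathcal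 B$. The extent of dilation is $$\Delta(A,\mathcal B)=\inf_{B\in\mathcal B}\{\overline E(A|B)-\underline E(A|B)-(\overline P(A)-\underline P(A))\}.$$ Put $\mathcal B_{>0}=\{B\in\mathcal B:\underline P(B)>0\}$ and $\mathcal B_A^+=\{B\in\mathcal B_{>0}:\underline E(A|B),\overline E(A|B)\in\,]0,1[\}$, $\mathcal B_A^1=\{B\in\mathcal B_{>0}:\underline E(A|B)\in\,]0,1[,\ \overline E(A|B)=1\}$, $\mathcal B_A^0=\{B\in\mathcal B_{>0}:\underline E(A|B)=0,\ \overline E(A|B)\in\,]0,1[\}$. *)

theory Defs
  imports "HOL-Analysis.Analysis"
begin

text \<open>
  The partition \<open>\<P>\<close> of the sure event is modelled by an arbitrary type \<open>'a\<close>, whose elements are the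
  atoms.  Events are the sets of atoms, so \<open>\<A>(\<P>)\<close> is the type \<open>'a set\<close> and the sure event is \<open>UNIV\<close>.
\<close>

definition fa_probability :: "('a set \<Rightarrow> real) \<Rightarrow> bool" where
  "fa_probability P \<longleftrightarrow>
     (\<forall>X. 0 \<le> P X) \<and> P UNIV = 1 \<and> Measure_Space.additive UNIV P"

definition vertical_barrier_model ::
    "('a set \<Rightarrow> real) \<Rightarrow> real \<Rightarrow> real \<Rightarrow> ('a set \<Rightarrow> real) \<Rightarrow> ('a set \<Rightarrow> real) \<Rightarrow> bool" where
  "vertical_barrier_model P\<^sub>0 a b Pl Pu \<longleftrightarrow>
     fa_probability P\<^sub>0 \<and> 0 < b \<and> a \<le> 0 \<and> 0 \<le> a + b \<and> a + b \<le> 1 \<and>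
     (\<forall>X. Pl X = (if X = UNIV then 1 else max (b * P\<^sub>0 X + a) 0)) \<and>
     (\<forall>X. Pu X = (if X = {} then 0 else min (b * P\<^sub>0 X + (1 - (a + b))) 1))"

definition credal_set :: "('a set \<Rightarrow> real) \<Rightarrow> ('a set \<Rightarrow> real) set" where
  "credal_set Pl = {P. fa_probability P \<and> (\<forall>X. Pl X \<le> P X)}"

text \<open>The second component of each pair is \<open>P(\<cdot>|B)\<close>.\<close>

definition conditional_credal_set ::
    "('a set \<Rightarrow> real) \<Rightarrow> 'a set \<Rightarrow> (('a set \<Rightarrow> real) \<times> ('a set \<Rightarrow> real)) set" where
  "conditional_credal_set Pl B =
     {(P, Q). P \<in> credal_set Pl \<and> fa_probability Q \<and> Q B = 1 \<and>
              (\<forall>X. P (X \<inter> B) = Q X * P B)}"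

text \<open>
  The natural extensions.  For a Vertical Barrier Model and \<open>B \<noteq> {}\<close> the conditional credal set is
  nonempty: it contains a pair with first component \<open>P\<^sub>0\<close>.  Hence these are infima and
  suprema of nonempty subsets of \<open>[0, 1]\<close>.
\<close>

definition lower_natext :: "('a set \<Rightarrow> real) \<Rightarrow> 'a set \<Rightarrow> 'a set \<Rightarrow> real" where
  "lower_natext Pl A B = (INF (P, Q) \<in> conditional_credal_set Pl B. Q A)"

definition upper_natext :: "('a set \<Rightarrow> real) \<Rightarrow> 'a set \<Rightarrow> 'a set \<Rightarrow> real" where
  "upper_natext Pl A B = (SUP (P, Q) \<in> conditional_credal_set Pl B. Q A)"

definition strictly_dilates ::
    "('a set \<Rightarrow> real) \<Rightarrow> ('a set \<Rightarrow> real) \<Rightarrow> 'a set set \<Rightarrow> 'a set \<Rightarrow> bool" where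
  "strictly_dilates Pl Pu \<B> A \<longleftrightarrow>
     (\<forall>B\<in>\<B>. lower_natext Pl A B < Pl A \<and> Pl A \<le> Pu A \<and> Pu A < upper_natext Pl A B)"

definition dilation_extent ::
    "('a set \<Rightarrow> real) \<Rightarrow> ('a set \<Rightarrow> real) \<Rightarrow> 'a set \<Rightarrow> 'a set set \<Rightarrow> real" where
  "dilation_extent Pl Pu A \<B> =
     (INF B\<in>\<B>. upper_natext Pl A B - lower_natext Pl A B - (Pu A - Pl A))"

definition blocks_pos :: "('a set \<Rightarrow> real) \<Rightarrow> 'a set set \<Rightarrow> 'a set set" where
  "blocks_pos Pl \<B> = {B \<in> \<B>. 0 < Pl B}"

text \<open>The sets \<open>\<B>\<^sub>A\<^sup>+\<close>, \<open>\<B>\<^sub>A\<^sup>1\<close> and \<open>\<B>\<^sub>A\<^sup>0\<close>, in this order.\<close>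

definition blocks_inner :: "('a set \<Rightarrow> real) \<Rightarrow> 'a set \<Rightarrow> 'a set set \<Rightarrow> 'a set set" where
  "blocks_inner Pl A \<B> =
     {B \<in> blocks_pos Pl \<B>. lower_natext Pl A B \<in> {0<..<1} \<and> upper_natext Pl A B \<in> {0<..<1}}"

definition blocks_one :: "('a set \<Rightarrow> real) \<Rightarrow> 'a set \<Rightarrow> 'a set set \<Rightarrow> 'a set set" where
  "blocks_one Pl A \<B> =
     {B \<in> blocks_pos Pl \<B>. lower_natext Pl A B \<in> {0<..<1} \<and> upper_natext Pl A B = 1}"

definition blocks_zero :: "('a set \<Rightarrow> real) \<Rightarrow> 'a set \<Rightarrow> 'a set set \<Rightarrow> 'a set set" where
  "blocks_zero Pl A \<B> =
     {B \<in> blocks_pos Pl \<B>. lower_natext Pl A B = 0 \<and> upper_natext Pl A B \<in> {0<..<1}}"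

text \<open>
  \<open>M\<^sub>0\<close> and \<open>M\<^sub>1\<close> as real suprema.  For a Vertical Barrier Model, whenever the index set is
  nonempty, all denominators are positive and the ratios are bounded: if \<open>a < 0\<close> there are only
  finitely many blocks of positive lower probability, and if \<open>a = 0\<close> the denominators are all
  \<open>1 - b > 0\<close>.  For an empty index set the value is meaningless.
\<close>

definition sup_ratio_zero ::
    "('a set \<Rightarrow> real) \<Rightarrow> ('a set \<Rightarrow> real) \<Rightarrow> 'a set \<Rightarrow> 'a set set \<Rightarrow> real" where
  "sup_ratio_zero Pl Pu A \<B> = (SUP B\<in>blocks_zero Pl A \<B>. Pl (- A \<inter> B) / Pu (A \<inter> B))"

definition sup_ratio_one ::
    "('a set \<Rightarrow> real) \<Rightarrow> ('a set \<Rightarrow> real) \<Rightarrow> 'a set \<Rightarrow> 'a set set \<Rightarrow> real" where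
  "sup_ratio_one Pl Pu A \<B> = (SUP B\<in>blocks_one Pl A \<B>. Pl (A \<inter> B) / Pu (- A \<inter> B))"

end

theory Submission
  imports Defs
begin

text \<open>
  Dilation forces every block \<open>B\<close> to meet both \<open>A\<close> and its complement.  For such blocks
  \<open>P(A|B) = P(A \<and> B) / P(B)\<close> is smallest when \<open>P(A \<and> B)\<close> is minimal and \<open>P(A\<^sup>c \<and> B)\<close> maximal;
  an explicit member of the credal set (a rescaling of \<open>P\<^sub>0\<close> on \<open>A \<and> B\<close> and off it, plus a point mass
  in \<open>A\<^sup>c \<and> B\<close>) attains both bounds at once, or just \<open>P(A \<and> B) = 0\<close> if the lower probability of
  \<open>A \<and> B\<close> vanishes, which then suffices.  This gives closed forms of the natural extensions.
  On \<open>\<B>\<^sub>A\<^sup>+\<close> their difference is \<open>(1 - b - 2a) / (b P\<^sub>0(B) + 1 - b)\<close>, which decreases in \<open>P\<^sub>0(B)\<close>; on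
  \<open>\<B>\<^sub>A\<^sup>0\<close> and \<open>\<B>\<^sub>A\<^sup>1\<close> it is \<open>1 / (1 + r)\<close> for the ratio \<open>r\<close> in question, and strict dilation itself bounds
  the ratios; on all other blocks it is \<open>1\<close>.
\<close>

section \<open>Finitely additive probabilities\<close>

lemma fa_probability_nonneg: "fa_probability P \<Longrightarrow> 0 \<le> P X"
  by (simp add: fa_probability_def)

lemma fa_probability_UNIV: "fa_probability P \<Longrightarrow> P UNIV = 1"
  by (simp add: fa_probability_def)

lemma fa_probability_Un:
  "fa_probability P \<Longrightarrow> X \<inter> Y = {} \<Longrightarrow> P (X \<union> Y) = P X + P Y"
  by (simp add: fa_probability_def additive_def)

lemma fa_probability_empty: "fa_probability P \<Longrightarrow> P {} = 0"
  using fa_probability_Un[of P "{}" "{}"] by simp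

lemma fa_probability_mono:
  assumes "fa_probability P" "X \<subseteq> Y" shows "P X \<le> P Y"
proof -
  have "P (X \<union> (Y - X)) = P X + P (Y - X)"
    using assms(1) by (intro fa_probability_Un) auto
  moreover have "X \<union> (Y - X) = Y" using assms(2) by auto
  ultimately show ?thesis using fa_probability_nonneg[OF assms(1), of "Y - X"] by simp
qed

lemma fa_probability_split:
  assumes "fa_probability P" shows "P B = P (A \<inter> B) + P (- A \<inter> B)"
proof -
  have "P ((A \<inter> B) \<union> (- A \<inter> B)) = P (A \<inter> B) + P (- A \<inter> B)"
    using assms by (intro fa_probability_Un) auto
  moreover have "(A \<inter> B) \<union> (- A \<inter> B) = B" by auto
  ultimately show ?thesis by simp
qed

lemma fa_probability_Compl:
  "fa_probability P \<Longrightarrow> P (- X) = 1 - P X"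
  using fa_probability_split[of P UNIV X] by (simp add: fa_probability_UNIV)

lemma fa_probability_le_1: "fa_probability P \<Longrightarrow> P X \<le> 1"
  using fa_probability_mono[of P X UNIV] by (simp add: fa_probability_UNIV)

text \<open>Both credal set witnesses below have this shape: \<open>P\<^sub>0\<close> rescaled
  separately on \<open>S\<close> and off it, with the missing mass \<open>r\<close> put at one
  atom.\<close>

lemma fa_probability_mixture:
  assumes P: "fa_probability P" and "0 \<le> k" "0 \<le> m" "0 \<le> r"
    and total: "k * P S + m * P (- S) + r = 1"
  shows "fa_probability (\<lambda>X. k * P (X \<inter> S) + m * P (X \<inter> - S) + r * of_bool (t \<in> X))"
proof -
  have "P ((X \<union> Y) \<inter> Z) = P (X \<inter> Z) + P (Y \<inter> Z)" if "X \<inter> Y = {}" for X Y Z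
    using that fa_probability_Un[OF P, of "X \<inter> Z" "Y \<inter> Z"] by (auto simp: Int_Un_distrib2)
  then show ?thesis
    using assms fa_probability_nonneg[OF P]
    by (auto simp: fa_probability_def additive_def algebra_simps)
qed

lemma fa_probability_point_mass: "fa_probability (\<lambda>X. of_bool (t \<in> X))"
  by (auto simp: fa_probability_def additive_def)

lemma fa_probability_conditional:
  assumes P: "fa_probability P" and "0 < P B"
  shows "fa_probability (\<lambda>X. P (X \<inter> B) / P B)"
proof -
  have "P ((X \<union> Y) \<inter> B) = P (X \<inter> B) + P (Y \<inter> B)" if "X \<inter> Y = {}" for X Y
    using that fa_probability_Un[OF P, of "X \<inter> B" "Y \<inter> B"] by (auto simp: Int_Un_distrib2)
  then show ?thesis
    using assms fa_probability_nonneg[OF P]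
    by (auto simp: fa_probability_def additive_def add_divide_distrib)
qed

section \<open>Disjoint families and their most probable members\<close>

lemma fa_probability_disjoint_sum:
  assumes P: "fa_probability P" and "finite G" "disjoint G"
  shows "(\<Sum>X\<in>G. P X) = P (\<Union>G)"
  using assms(2,3)
proof (induction G rule: finite_induct)
  case empty
  then show ?case by (simp add: fa_probability_empty[OF P])
next
  case (insert X G)
  have "X \<inter> \<Union>G = {}"
    using insert.prems insert.hyps by (auto simp: disjoint_def)
  moreover have "disjoint G"
    using insert.prems by (auto simp: disjoint_def)
  ultimately show ?case
    using insert fa_probability_Un[OF P, of X "\<Union>G"] by simp
qed

text \<open>More than \<open>1 / e\<close> disjoint events of probability at least \<open>e\<close>
  would have a union of probability above 1.\<close>

lemma finite_blocks_above:
  assumes P: "fa_probability P" and "disjoint \<C>" and "0 < e"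
  shows "finite {X \<in> \<C>. e \<le> P X}"
proof (rule ccontr)
  assume inf: "infinite {X \<in> \<C>. e \<le> P X}"
  obtain n :: nat where n: "1 / e < real n" using reals_Archimedean2 by blast
  obtain G where G: "G \<subseteq> {X \<in> \<C>. e \<le> P X}" "finite G" "card G = n"
    using infinite_arbitrarily_large[OF inf] by blast
  have "real n * e = (\<Sum>X\<in>G. e)" using G by simp
  also have "\<dots> \<le> (\<Sum>X\<in>G. P X)" using G by (intro sum_mono) auto
  also have "\<dots> = P (\<Union>G)"
    using G assms(2) by (intro fa_probability_disjoint_sum[OF P]) (auto simp: disjoint_def)
  also have "\<dots> \<le> 1" by (rule fa_probability_le_1[OF P])
  finally show False using n \<open>0 < e\<close> by (simp add: field_simps)
qed

text \<open>The family may be infinite, but only finitely many members are at least as probable as a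
  fixed member \<open>B\<close>, and a maximum over these is global.\<close>

lemma ex_arg_max_disjoint:
  assumes P: "fa_probability P" and "disjoint \<C>" and pos: "\<And>X. X \<in> \<C> \<Longrightarrow> 0 < P X"
    and "\<C> \<noteq> {}"
  shows "\<exists>M. is_arg_max P (\<lambda>X. X \<in> \<C>) M"
proof -
  obtain B where B: "B \<in> \<C>" using assms(4) by blast
  let ?F = "{X \<in> \<C>. P B \<le> P X}"
  have "finite ?F" by (intro finite_blocks_above assms pos B)
  moreover have "?F \<noteq> {}" using B by auto
  ultimately obtain M where M: "M \<in> ?F" "Max (P ` ?F) = P M"
    using Max_in[of "P ` ?F"] by fastforce
  have "P X \<le> P M" if "X \<in> \<C>" for X
  proof (cases "P B \<le> P X")
    case True
    then show ?thesis using that M(2) \<open>finite ?F\<close> Max_ge[of "P ` ?F" "P X"] by auto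
  next
    case False
    then show ?thesis using M(1) by auto
  qed
  then show ?thesis using M(1) by (auto simp: is_arg_max_def not_less)
qed

section \<open>Conditional probabilities, null conditioning events included\<close>

text \<open>For \<open>P B > 0\<close> the product rule forces the quotient. For
  \<open>P B = 0\<close> it is vacuous, and a point mass is taken because its value on an event is
  controlled by the choice of \<open>t\<close>.\<close>

lemma conditional_credal_set_extend:
  assumes "P \<in> credal_set Pl" and "t \<in> B"
  obtains Q where "(P, Q) \<in> conditional_credal_set Pl B"
    "P B = 0 \<longrightarrow> (\<forall>X. Q X = of_bool (t \<in> X))"
proof -
  have P: "fa_probability P" using assms(1) by (simp add: credal_set_def)
  show ?thesis
  proof (cases "P B = 0")
    case True
    have "P (X \<inter> B) = 0" for X
      using fa_probability_mono[OF P, of "X \<inter> B" B] fa_probability_nonneg[OF P, of "X \<inter> B"] True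
      by simp
    then show ?thesis
      using that[of "\<lambda>X. of_bool (t \<in> X)"] assms True
      by (simp add: conditional_credal_set_def fa_probability_point_mass)
  next
    case False
    then have "0 < P B" using fa_probability_nonneg[OF P, of B] by simp
    then show ?thesis
      using that[of "\<lambda>X. P (X \<inter> B) / P B"] assms False
      by (simp add: conditional_credal_set_def fa_probability_conditional[OF P])
  qed
qed

section \<open>Bounds of the Vertical Barrier Model\<close>

context
  fixes P\<^sub>0 Pl Pu :: "'a set \<Rightarrow> real" and a b :: real
  assumes vbm: "vertical_barrier_model P\<^sub>0 a b Pl Pu"
begin

lemma vbm_probability: "fa_probability P\<^sub>0"
  and vbm_parameters: "0 < b" "a \<le> 0" "0 \<le> a + b" "a + b \<le> 1"
  and vbm_lower: "Pl X = (if X = UNIV then 1 else max (b * P\<^sub>0 X + a) 0)"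
  and vbm_upper: "Pu X = (if X = {} then 0 else min (b * P\<^sub>0 X + (1 - (a + b))) 1)"
  using vbm by (simp_all add: vertical_barrier_model_def)

lemma vbm_conjugate: "Pu X = 1 - Pl (- X)"
  by (auto simp: vbm_lower vbm_upper fa_probability_Compl[OF vbm_probability]
      algebra_simps min_def max_def)

lemma vbm_lower_nonneg: "0 \<le> Pl X"
  by (simp add: vbm_lower)

lemma vbm_lower_ge: "b * P\<^sub>0 X + a \<le> Pl X"
  using vbm_parameters by (simp add: vbm_lower fa_probability_UNIV[OF vbm_probability])

lemma vbm_lower_mono: "X \<subseteq> Y \<Longrightarrow> Pl X \<le> Pl Y"
  using vbm_parameters fa_probability_mono[OF vbm_probability, of X Y]
    fa_probability_le_1[OF vbm_probability, of X]
  by (auto simp: vbm_lower max_def intro: order_trans[OF add_right_mono[OF mult_left_mono]])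

lemma vbm_lower_pos:
  assumes "X \<noteq> UNIV" "0 < Pl X"
  shows "Pl X = b * P\<^sub>0 X + a" "0 < P\<^sub>0 X"
proof -
  show *: "Pl X = b * P\<^sub>0 X + a" using assms by (auto simp: vbm_lower max_def split: if_splits)
  then have "0 < b * P\<^sub>0 X" using assms vbm_parameters by linarith
  then show "0 < P\<^sub>0 X" using vbm_parameters by (simp add: zero_less_mult_iff)
qed

section \<open>Members of the credal set that attain the bounds\<close>

lemma credal_set_bounds:
  assumes "P \<in> credal_set Pl" shows "Pl X \<le> P X" "P X \<le> Pu X"
proof -
  show "Pl X \<le> P X" using assms by (simp add: credal_set_def)
  have "Pl (- X) \<le> P (- X)" "fa_probability P" using assms by (simp_all add: credal_set_def)
  then show "P X \<le> Pu X" using fa_probability_Compl[of P X] by (simp add: vbm_conjugate)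
qed

text \<open>Only the affine bound has to be checked: the truncation at 0 and the value at
  \<open>UNIV\<close> are respected by every probability.\<close>

lemma credal_setI:
  assumes "fa_probability P" and "\<And>X. b * P\<^sub>0 X + a \<le> P X"
  shows "P \<in> credal_set Pl"
  using assms fa_probability_nonneg[OF assms(1)]
  by (auto simp: credal_set_def vbm_lower fa_probability_UNIV)

text \<open>As \<open>b * P\<^sub>0 S + a\<close> is at most 0, emptying \<open>S\<close> costs no
  more than the slack \<open>-a\<close>. Outside \<open>S\<close> the mass is rescaled by
  \<open>k\<close>, and what is missing to 1 goes to an atom outside \<open>S\<close>.\<close>

lemma credal_set_attains_zero:
  assumes "S \<noteq> UNIV" and "Pl S = 0"
  obtains P where "P \<in> credal_set Pl" "P S = 0"
proof -
  note P0 = vbm_probability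
  obtain t where t: "t \<notin> S" using assms(1) by blast
  have S: "b * P\<^sub>0 S + a \<le> 0" using vbm_lower_ge[of S] assms(2) by simp
  define m where "m = P\<^sub>0 (- S)"
  have PS: "P\<^sub>0 S = 1 - m" by (simp add: m_def fa_probability_Compl[OF P0])
  have m: "0 \<le> m" using fa_probability_nonneg[OF P0] by (simp add: m_def)
  \<comment> \<open>\<open>b\<close> may exceed 1, and scaling by \<open>b\<close> could then give a
    total above 1. In that case \<open>1 / m\<close> uses up the whole mass and the atom
    \<open>t\<close> gets none.\<close>
  define k where "k = (if b * m \<le> 1 then b else 1 / m)"
  have k: "0 \<le> k" "k * m \<le> 1" using m vbm_parameters by (auto simp: k_def)
  define P where
    "P X = 0 * P\<^sub>0 (X \<inter> S) + k * P\<^sub>0 (X \<inter> - S) + (1 - k * m) * of_bool (t \<in> X)" for X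
  have fa: "fa_probability P"
    unfolding P_def using k by (intro fa_probability_mixture[OF P0]) (auto simp: m_def)
  have "b * P\<^sub>0 X + a \<le> P X" for X
  proof -
    define x where "x = P\<^sub>0 (X \<inter> - S)"
    have X: "P\<^sub>0 X = P\<^sub>0 (X \<inter> S) + x"
      using fa_probability_split[OF P0, of X S] by (simp add: x_def Int_commute)
    have "P\<^sub>0 (X \<inter> S) \<le> P\<^sub>0 S" by (rule fa_probability_mono[OF P0]) auto
    then have le: "b * P\<^sub>0 X + a \<le> b * x + (b * (1 - m) + a)"
      using vbm_parameters mult_left_mono[of "P\<^sub>0 (X \<inter> S)" "1 - m" b] X
      by (simp add: algebra_simps PS)
    have x: "0 \<le> x" "x \<le> m"
      unfolding x_def m_def by (auto intro: fa_probability_nonneg[OF P0] fa_probability_mono[OF P0])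
    have ge: "k * x \<le> P X" using k by (simp add: P_def x_def)
    have "b * x + (b * (1 - m) + a) \<le> k * x"
    proof (cases "b * m \<le> 1")
      case True
      then show ?thesis using S by (simp add: k_def PS)
    next
      case False
      then have m0: "0 < m" using m by (cases "m = 0") auto
      \<comment> \<open>Both sides are affine in \<open>x\<close>, and the inequality holds at \<open>x = 0\<close> and at \<open>x = m\<close>.\<close>
      have "(b * x + (b * (1 - m) + a)) * m
          = (b * (1 - m) + a) * (m - x) + (a + b) * x"
        by (simp add: algebra_simps)
      also have "\<dots> \<le> 0 + 1 * x"
        using S x vbm_parameters
        by (intro add_mono mult_right_mono mult_nonpos_nonneg) (auto simp: PS)
      finally show ?thesis using m0 False by (simp add: k_def field_simps)
    qed
    with le ge show ?thesis by linarith
  qed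
  with fa have "P \<in> credal_set Pl" by (intro credal_setI)
  moreover have "P S = 0" using t by (simp add: P_def fa_probability_empty[OF P0])
  ultimately show ?thesis by (rule that)
qed

text \<open>\<open>S\<close> is scaled down to exactly its lower probability, its complement keeps
  the factor \<open>b\<close>, and the remaining mass \<open>1 - (a + b)\<close> goes into
  \<open>T\<close>. One probability thus reaches both extremes.\<close>

lemma credal_set_attains_pos:
  assumes "S \<inter> T = {}" "T \<noteq> {}" and "0 < Pl S"
  obtains P where "P \<in> credal_set Pl" "P S = Pl S" "P T = Pu T"
proof -
  note P0 = vbm_probability
  obtain t where t: "t \<in> T" using assms(2) by blast
  have "S \<noteq> UNIV" using assms by auto
  note S = vbm_lower_pos[OF this assms(3)]
  define k where "k = Pl S / P\<^sub>0 S"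
  have k: "0 \<le> k" "k * P\<^sub>0 S = Pl S" using S(2) assms(3) by (auto simp: k_def)
  define P where
    "P X = k * P\<^sub>0 (X \<inter> S) + b * P\<^sub>0 (X \<inter> - S) + (1 - (a + b)) * of_bool (t \<in> X)" for X
  have fa: "fa_probability P"
    unfolding P_def using k S vbm_parameters
    by (intro fa_probability_mixture[OF P0])
      (auto simp: fa_probability_Compl[OF P0] algebra_simps)
  have "b * P\<^sub>0 X + a \<le> P X" for X
  proof -
    have X: "P\<^sub>0 X = P\<^sub>0 (X \<inter> S) + P\<^sub>0 (X \<inter> - S)"
      using fa_probability_split[OF P0, of X S] by (simp add: Int_commute)
    have "P\<^sub>0 (X \<inter> S) \<le> P\<^sub>0 S" by (rule fa_probability_mono[OF P0]) auto
    moreover have "k \<le> b" using S vbm_parameters by (simp add: k_def field_simps)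
    \<comment> \<open>The loss from using \<open>k\<close> instead of \<open>b\<close> on part of
      \<open>S\<close> is at most the loss on all of \<open>S\<close>, which is exactly the slack
      \<open>-a\<close>.\<close>
    ultimately have "(b - k) * P\<^sub>0 (X \<inter> S) \<le> (b - k) * P\<^sub>0 S"
      by (intro mult_left_mono) auto
    also have "\<dots> = - a" using k S by (simp add: algebra_simps)
    finally have "b * P\<^sub>0 X + a \<le> k * P\<^sub>0 (X \<inter> S) + b * P\<^sub>0 (X \<inter> - S)"
      by (simp add: X algebra_simps)
    then show ?thesis using vbm_parameters by (simp add: P_def)
  qed
  with fa have mem: "P \<in> credal_set Pl" by (intro credal_setI)
  have "t \<notin> S" using t assms(1) by auto
  then have 1: "P S = Pl S" using k by (simp add: P_def fa_probability_empty[OF P0])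
  have "T \<inter> S = {}" "T \<inter> - S = T" using assms(1) by auto
  then have "P T = b * P\<^sub>0 T + (1 - (a + b))"
    using t by (simp add: P_def fa_probability_empty[OF P0])
  \<comment> \<open>Only the truncation at 1 could separate \<open>Pu T\<close> from
    \<open>P T\<close>; membership in the credal set supplies the converse inequality.\<close>
  moreover have "Pu T \<le> b * P\<^sub>0 T + (1 - (a + b))" using assms(2) by (simp add: vbm_upper)
  ultimately have "P T = Pu T" using credal_set_bounds(2)[OF mem, of T] by simp
  with mem 1 show ?thesis by (rule that)
qed

section \<open>Closed forms of the natural extensions\<close>

text \<open>If the numerator vanishes the value is 0, even when the denominator vanishes too; this
  is the correct natural extension in that case as well.\<close>

definition lower_conditional :: "'a set \<Rightarrow> 'a set \<Rightarrow> real" where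
  "lower_conditional A B = Pl (A \<inter> B) / (Pl (A \<inter> B) + Pu (- A \<inter> B))"

lemma lower_conditional_le:
  assumes "(P, Q) \<in> conditional_credal_set Pl B"
  shows "lower_conditional A B \<le> Q A"
proof (cases "Pl (A \<inter> B) = 0")
  case True
  then show ?thesis
    using assms fa_probability_nonneg[of Q A]
    by (simp add: lower_conditional_def conditional_credal_set_def)
next
  case False
  have PQ: "P \<in> credal_set Pl" "fa_probability P" "P (A \<inter> B) = Q A * P B"
    using assms by (auto simp: conditional_credal_set_def credal_set_def)
  have pos: "0 < Pl (A \<inter> B)" using False vbm_lower_nonneg[of "A \<inter> B"] by simp
  have le: "Pl (A \<inter> B) \<le> P (A \<inter> B)" "P (- A \<inter> B) \<le> Pu (- A \<inter> B)"
    by (rule credal_set_bounds[OF PQ(1)])+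
  have B: "P B = P (A \<inter> B) + P (- A \<inter> B)" by (rule fa_probability_split[OF PQ(2)])
  have nonneg: "0 \<le> P (- A \<inter> B)" by (rule fa_probability_nonneg[OF PQ(2)])
  \<comment> \<open>With denominators cleared, this is the monotonicity of
    \<open>s / (s + t)\<close>: increasing in \<open>s\<close>, decreasing in
    \<open>t\<close>.\<close>
  have "Pl (A \<inter> B) * P (- A \<inter> B) \<le> P (A \<inter> B) * Pu (- A \<inter> B)"
    using le pos nonneg by (intro mult_mono) auto
  then have "lower_conditional A B \<le> P (A \<inter> B) / P B"
    using le pos nonneg B by (simp add: lower_conditional_def divide_simps algebra_simps)
  also have "\<dots> = Q A" using PQ(3) B le pos nonneg by (simp add: field_simps)
  finally show ?thesis .
qed

lemma lower_conditional_attained: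
  assumes "- A \<inter> B \<noteq> {}"
  obtains P Q where "(P, Q) \<in> conditional_credal_set Pl B" "Q A = lower_conditional A B"
proof -
  obtain t where t: "t \<in> B" "t \<notin> A" using assms by blast
  show ?thesis
  proof (cases "Pl (A \<inter> B) = 0")
    case True
    have "A \<inter> B \<noteq> UNIV" using t by auto
    then obtain P where P: "P \<in> credal_set Pl" "P (A \<inter> B) = 0"
      using True by (rule credal_set_attains_zero)
    obtain Q where Q: "(P, Q) \<in> conditional_credal_set Pl B"
        "P B = 0 \<longrightarrow> (\<forall>X. Q X = of_bool (t \<in> X))"
      by (rule conditional_credal_set_extend[OF P(1) t(1)])
    have "Q A * P B = 0" using Q(1) P(2) by (auto simp: conditional_credal_set_def)
    \<comment> \<open>If \<open>P B\<close> is nonzero, the product rule gives this; if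
      \<open>P B = 0\<close>, \<open>Q\<close> is the point mass at \<open>t\<close>, which was
      chosen outside \<open>A\<close>.\<close>
    then have "Q A = 0" using Q(2) t(2) by auto
    then show ?thesis using that[OF Q(1)] True by (simp add: lower_conditional_def)
  next
    case False
    then have pos: "0 < Pl (A \<inter> B)" using vbm_lower_nonneg[of "A \<inter> B"] by simp
    obtain P where P: "P \<in> credal_set Pl" "P (A \<inter> B) = Pl (A \<inter> B)"
        "P (- A \<inter> B) = Pu (- A \<inter> B)"
      by (rule credal_set_attains_pos[OF _ assms pos]) auto
    obtain Q where Q: "(P, Q) \<in> conditional_credal_set Pl B"
      by (rule conditional_credal_set_extend[OF P(1) t(1)])
    have fa: "fa_probability P" using P(1) by (simp add: credal_set_def)
    have B: "P B = Pl (A \<inter> B) + Pu (- A \<inter> B)"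
      using fa_probability_split[OF fa, of B A] P by simp
    have "P B > 0" using B pos fa_probability_nonneg[OF fa, of "- A \<inter> B"] P(3) by simp
    moreover have "Q A * P B = Pl (A \<inter> B)"
      using Q P(2) by (auto simp: conditional_credal_set_def)
    ultimately have "Q A = lower_conditional A B"
      by (simp add: lower_conditional_def B field_simps)
    then show ?thesis using that[OF Q] by simp
  qed
qed

lemma lower_natext_eq:
  assumes "- A \<inter> B \<noteq> {}"
  shows "lower_natext Pl A B = lower_conditional A B"
proof -
  obtain P Q where "(P, Q) \<in> conditional_credal_set Pl B" "Q A = lower_conditional A B"
    using lower_conditional_attained[OF assms] .
  then show ?thesis
    unfolding lower_natext_def
    by (intro cInf_eq_minimum) (force, auto intro: lower_conditional_le)
qed

text \<open>Since \<open>Q A = 1 - Q (- A)\<close>, the supremum is the complement of the minimum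
  for \<open>- A\<close>, whose attainment requires that \<open>B\<close> meets
  \<open>A\<close>.\<close>

lemma upper_natext_eq:
  assumes "A \<inter> B \<noteq> {}"
  shows "upper_natext Pl A B = 1 - lower_conditional (- A) B"
proof -
  have compl: "Q A = 1 - Q (- A)" if "(P, Q) \<in> conditional_credal_set Pl B" for P Q
    using that fa_probability_Compl[of Q A] by (simp add: conditional_credal_set_def)
  have "- (- A) \<inter> B \<noteq> {}" using assms by simp
  then obtain P Q
    where PQ: "(P, Q) \<in> conditional_credal_set Pl B" "Q (- A) = lower_conditional (- A) B"
    by (rule lower_conditional_attained)
  show ?thesis
    unfolding upper_natext_def
  proof (rule cSup_eq_maximum)
    show "1 - lower_conditional (- A) B
        \<in> (\<lambda>(P, Q). Q A) ` conditional_credal_set Pl B"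
      using PQ compl[OF PQ(1)] by force
  next
    fix y assume "y \<in> (\<lambda>(P, Q). Q A) ` conditional_credal_set Pl B"
    then show "y \<le> 1 - lower_conditional (- A) B"
      by (auto simp: compl lower_conditional_le)
  qed
qed

text \<open>Real \<open>INF\<close> and \<open>SUP\<close> are informative only over nonempty sets;
  this justifies the two bounds that follow.\<close>

lemma conditional_credal_set_nonempty:
  assumes "B \<noteq> {}" shows "conditional_credal_set Pl B \<noteq> {}"
proof -
  have "Pl {} = 0"
    using vbm_parameters by (simp add: vbm_lower fa_probability_empty[OF vbm_probability])
  then obtain P where "P \<in> credal_set Pl"
    by (rule credal_set_attains_zero[OF empty_not_UNIV])
  moreover obtain t where "t \<in> B" using assms by blast
  ultimately obtain Q where "(P, Q) \<in> conditional_credal_set Pl B"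
    by (rule conditional_credal_set_extend)
  then show ?thesis by blast
qed

text \<open>Every admissible \<open>Q\<close> has \<open>Q A >= Q B = 1\<close>. This rules out
  dilating blocks inside \<open>A\<close>.\<close>

lemma lower_natext_subset:
  assumes "B \<noteq> {}" "B \<subseteq> A" shows "lower_natext Pl A B \<ge> 1"
  unfolding lower_natext_def
proof (rule cINF_greatest[OF conditional_credal_set_nonempty[OF assms(1)]])
  fix PQ assume "PQ \<in> conditional_credal_set Pl B"
  then show "1 \<le> (case PQ of (P, Q) \<Rightarrow> Q A)"
    using fa_probability_mono[OF _ assms(2)] by (fastforce simp: conditional_credal_set_def)
qed

text \<open>\<open>Q B = 1\<close> leaves no mass for an event disjoint from \<open>B\<close>. This
  rules out dilating blocks that miss \<open>A\<close>.\<close>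

lemma upper_natext_disjoint:
  assumes "B \<noteq> {}" "A \<inter> B = {}" shows "upper_natext Pl A B \<le> 0"
  unfolding upper_natext_def
proof (rule cSUP_least[OF conditional_credal_set_nonempty[OF assms(1)]])
  fix PQ assume "PQ \<in> conditional_credal_set Pl B"
  then show "(case PQ of (P, Q) \<Rightarrow> Q A) \<le> 0"
    using fa_probability_Un[OF _ assms(2)]
    by (fastforce simp: conditional_credal_set_def dest: fa_probability_le_1[of _ "A \<union> B"])
qed

section \<open>Positivity and width of the natural extensions\<close>

lemma vbm_lower_le_1: "Pl X \<le> 1"
  using vbm_lower_mono[of X UNIV] by (simp add: vbm_lower)

lemma vbm_upper_nonneg: "0 \<le> Pu X"
  using vbm_lower_le_1[of "- X"] by (simp add: vbm_conjugate)

lemma lower_conditional_nonneg: "0 \<le> lower_conditional A B"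
  by (simp add: lower_conditional_def vbm_lower_nonneg vbm_upper_nonneg)

lemma lower_conditional_pos_iff: "0 < lower_conditional A B \<longleftrightarrow> 0 < Pl (A \<inter> B)"
  using vbm_lower_nonneg[of "A \<inter> B"] vbm_upper_nonneg[of "- A \<inter> B"]
  by (auto simp: lower_conditional_def zero_less_divide_iff)

text \<open>The identity \<open>1 - p / (p + q) = 1 / (1 + p / q)\<close> breaks down for
  \<open>q = 0 < p\<close>, which the assumption excludes; for \<open>p = q = 0\<close> both sides
  are 1 because \<open>0 / 0 = 0\<close>.\<close>

lemma one_minus_lower_conditional:
  assumes "lower_conditional A B < 1"
  shows "1 - lower_conditional A B = 1 / (1 + Pl (A \<inter> B) / Pu (- A \<inter> B))"
proof (cases "Pu (- A \<inter> B) = 0")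
  case True
  then show ?thesis using assms by (simp add: lower_conditional_def split: if_splits)
next
  case False
  then have "0 < Pu (- A \<inter> B)" using vbm_upper_nonneg[of "- A \<inter> B"] by simp
  then show ?thesis
    using vbm_lower_nonneg[of "A \<inter> B"]
    by (simp add: lower_conditional_def divide_simps)
qed

text \<open>By conjugacy, a positive lower probability of \<open>A \<inter> B\<close> keeps
  \<open>Pu (- A \<inter> B)\<close> below 1, so neither truncation is active. In the denominator
  \<open>a\<close> cancels and only \<open>P\<^sub>0 B\<close> remains.\<close>

lemma lower_conditional_pos_eq:
  assumes "- A \<inter> B \<noteq> {}" and pos: "0 < Pl (A \<inter> B)"
  shows "lower_conditional A B = (b * P\<^sub>0 (A \<inter> B) + a) / (b * P\<^sub>0 B + 1 - b)"
    and "0 < b * P\<^sub>0 B + 1 - b" and "0 < P\<^sub>0 B"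
proof -
  note P0 = vbm_probability
  have "A \<inter> B \<noteq> UNIV" using assms(1) by auto
  note AB = vbm_lower_pos[OF this pos]
  have "Pl (A \<inter> B) \<le> Pl (- (- A \<inter> B))" by (rule vbm_lower_mono) auto
  then have "Pu (- A \<inter> B) < 1" using pos by (simp add: vbm_conjugate)
  then have upper: "Pu (- A \<inter> B) = b * P\<^sub>0 (- A \<inter> B) + (1 - (a + b))"
    using assms(1) by (simp add: vbm_upper min_def split: if_splits)
  have sum: "Pl (A \<inter> B) + Pu (- A \<inter> B) = b * P\<^sub>0 B + 1 - b"
    unfolding AB(1) upper fa_probability_split[OF P0, of B A] by (simp add: algebra_simps)
  show "lower_conditional A B = (b * P\<^sub>0 (A \<inter> B) + a) / (b * P\<^sub>0 B + 1 - b)"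
    unfolding lower_conditional_def sum by (simp add: AB(1))
  show "0 < b * P\<^sub>0 B + 1 - b"
    using sum pos vbm_upper_nonneg[of "- A \<inter> B"] by simp
  show "0 < P\<^sub>0 B" using AB(2) fa_probability_mono[OF P0, of "A \<inter> B" B] by simp
qed

text \<open>The closed forms for \<open>A\<close> and \<open>- A\<close> share their denominator,
  and the two numerators add up to \<open>b * P\<^sub>0 B + 2 * a\<close>. Hence the width depends
  on \<open>B\<close> only through \<open>P\<^sub>0 B\<close>.\<close>

lemma natext_width_inner:
  assumes "A \<inter> B \<noteq> {}" "- A \<inter> B \<noteq> {}" "0 < Pl (A \<inter> B)" "0 < Pl (- A \<inter> B)"
  shows "upper_natext Pl A B - lower_natext Pl A B = (1 - b - 2 * a) / (b * P\<^sub>0 B + 1 - b)"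
proof -
  have pos: "0 < b * P\<^sub>0 B + 1 - b" using lower_conditional_pos_eq(2)[of A B] assms by blast
  have "b * P\<^sub>0 B = b * P\<^sub>0 (A \<inter> B) + b * P\<^sub>0 (- A \<inter> B)"
    by (subst fa_probability_split[OF vbm_probability, of B A]) (simp add: algebra_simps)
  then show ?thesis
    using lower_conditional_pos_eq(1)[of A B] lower_conditional_pos_eq(1)[of "- A" B] assms pos
    by (simp add: lower_natext_eq upper_natext_eq field_simps)
qed

end

section \<open>Turning a supremum of ratios into an infimum of widths\<close>

text \<open>\<open>1 / (1 + t)\<close> is continuous and decreasing for nonnegative
  \<open>t\<close>. The uniform bound \<open>e\<close> keeps the ratios below
  \<open>1 / e - 1\<close>, so that the real supremum is meaningful.\<close>

lemma INF_inverse_one_plus: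
  fixes r :: "'b \<Rightarrow> real"
  assumes "S \<noteq> {}" and nonneg: "\<And>x. x \<in> S \<Longrightarrow> 0 \<le> r x"
    and "0 < e" and lower: "\<And>x. x \<in> S \<Longrightarrow> e \<le> 1 / (1 + r x)"
  shows "(INF x\<in>S. 1 / (1 + r x)) = 1 / (1 + (SUP x\<in>S. r x))"
proof (rule cInf_eq_non_empty)
  \<comment> \<open>Used twice: with \<open>y = e\<close> for boundedness, and with an arbitrary
    positive lower bound \<open>y\<close> to show that the infimum is greatest.\<close>
  have swap: "r x \<le> 1 / y - 1" if "x \<in> S" "0 < y" "y \<le> 1 / (1 + r x)" for x y
    using that nonneg[of x] by (simp add: field_simps)
  have bdd: "bdd_above (r ` S)"
    by (rule bdd_aboveI[of _ "1 / e - 1"]) (use swap assms in blast)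
  show "(\<lambda>x. 1 / (1 + r x)) ` S \<noteq> {}" using assms(1) by simp
  show "1 / (1 + (SUP x\<in>S. r x)) \<le> z" if z: "z \<in> (\<lambda>x. 1 / (1 + r x)) ` S" for z
  proof -
    obtain x where x: "x \<in> S" "z = 1 / (1 + r x)" using z by blast
    have "r x \<le> (SUP x\<in>S. r x)" by (rule cSUP_upper[OF x(1) bdd])
    then show ?thesis using nonneg[OF x(1)] x(2) by (simp add: frac_le)
  qed
  fix y assume y: "\<And>z. z \<in> (\<lambda>x. 1 / (1 + r x)) ` S \<Longrightarrow> y \<le> z"
  obtain x where x: "x \<in> S" using assms(1) by blast
  have M: "0 \<le> (SUP x\<in>S. r x)" using cSUP_upper[OF x bdd] nonneg[OF x] by simp
  show "y \<le> 1 / (1 + (SUP x\<in>S. r x))"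
  proof (cases "0 < y")
    case True
    have "(SUP x\<in>S. r x) \<le> 1 / y - 1"
      using y True by (intro cSUP_least assms(1) swap) auto
    then show ?thesis using True M by (simp add: field_simps)
  next
    case False
    moreover have "0 \<le> 1 / (1 + (SUP x\<in>S. r x))" using M by simp
    ultimately show ?thesis by linarith
  qed
qed

section \<open>The extent of dilation\<close>

theorem theorem5p2:
  fixes P\<^sub>0 Pl Pu :: "'a set \<Rightarrow> real" and a b :: real
    and A :: "'a set" and \<B> :: "'a set set"
  assumes vbm: "vertical_barrier_model P\<^sub>0 a b Pl Pu"
    and partition: "partition_on UNIV \<B>"
    and dilation: "strictly_dilates Pl Pu \<B> A"
  shows "(blocks_inner Pl A \<B> \<noteq> {} \<longrightarrow>
            (\<exists>Bs. is_arg_max P\<^sub>0 (\<lambda>B. B \<in> blocks_inner Pl A \<B>) Bs)) \<and>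
         (\<forall>Bs. (blocks_inner Pl A \<B> \<noteq> {} \<longrightarrow>
                  is_arg_max P\<^sub>0 (\<lambda>B. B \<in> blocks_inner Pl A \<B>) Bs) \<longrightarrow>
            dilation_extent Pl Pu A \<B> =
              Pl A - Pu A +
              Min ({1}
                \<union> (if blocks_inner Pl A \<B> = {} then {}
                   else {upper_natext Pl A Bs - lower_natext Pl A Bs})
                \<union> (if blocks_zero Pl A \<B> = {} then {}
                   else {1 / (1 + sup_ratio_zero Pl Pu A \<B>)})
                \<union> (if blocks_one Pl A \<B> = {} then {}
                   else {1 / (1 + sup_ratio_one Pl Pu A \<B>)})))"
proof -
  note P0 = vbm_probability[OF vbm]
  let ?l = "lower_natext Pl A" and ?u = "upper_natext Pl A"
  define w where "w B = ?u B - ?l B" for B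
  have dil: "?l B < Pl A" "Pl A \<le> Pu A" "Pu A < ?u B" if "B \<in> \<B>" for B
    using dilation that by (auto simp: strictly_dilates_def)
  have nonempty: "B \<noteq> {}" if "B \<in> \<B>" for B
    using partition that by (auto simp: partition_on_def)
  \<comment> \<open>On a block inside \<open>A\<close> the lower extension would be at least 1, on a
    block missing \<open>A\<close> the upper one at most 0; strict dilation excludes both.\<close>
  have meets: "A \<inter> B \<noteq> {}" "- A \<inter> B \<noteq> {}" if B: "B \<in> \<B>" for B
  proof -
    show "A \<inter> B \<noteq> {}"
      using upper_natext_disjoint[OF vbm nonempty[OF B], of A] dil[OF B]
        vbm_upper_nonneg[OF vbm, of A] by linarith
    show "- A \<inter> B \<noteq> {}"
      using lower_natext_subset[OF vbm nonempty[OF B], of A] dil[OF B]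
        vbm_lower_le_1[OF vbm, of A] by force
  qed
  have l: "?l B = lower_conditional Pl Pu A B"
    and u: "?u B = 1 - lower_conditional Pl Pu (- A) B" if "B \<in> \<B>" for B
    using meets[OF that] lower_natext_eq[OF vbm] upper_natext_eq[OF vbm] by blast+
  have l01: "0 \<le> ?l B" "?l B < 1" and u01: "0 < ?u B" "?u B \<le> 1" if "B \<in> \<B>" for B
    using dil[OF that] vbm_lower_le_1[OF vbm, of A] vbm_upper_nonneg[OF vbm, of A]
      lower_conditional_nonneg[OF vbm, of A B] lower_conditional_nonneg[OF vbm, of "- A" B]
      l[OF that] u[OF that] by linarith+
  have l_pos: "0 < ?l B \<longleftrightarrow> 0 < Pl (A \<inter> B)"
    and u_less_1: "?u B < 1 \<longleftrightarrow> 0 < Pl (- A \<inter> B)" if "B \<in> \<B>" for B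
    using l[OF that] u[OF that] lower_conditional_pos_iff[OF vbm] by simp_all

  have inner: "B \<in> \<B>" "0 < Pl (A \<inter> B)" "0 < Pl (- A \<inter> B)"
    if "B \<in> blocks_inner Pl A \<B>" for B
    using that l_pos u_less_1 by (auto simp: blocks_inner_def blocks_pos_def)
  have w_inner: "w B = (1 - b - 2 * a) / (b * P\<^sub>0 B + 1 - b)" "0 < b * P\<^sub>0 B + 1 - b" "0 < P\<^sub>0 B"
    if "B \<in> blocks_inner Pl A \<B>" for B
    using inner[OF that] meets natext_width_inner[OF vbm, of A B]
      lower_conditional_pos_eq(2,3)[OF vbm, of A B] by (auto simp: w_def)
  have "disjoint (blocks_inner Pl A \<B>)"
    using partition inner(1) by (auto simp: partition_on_def disjoint_def)
  then have ex: "\<exists>Bs. is_arg_max P\<^sub>0 (\<lambda>B. B \<in> blocks_inner Pl A \<B>) Bs"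
    if "blocks_inner Pl A \<B> \<noteq> {}"
    using ex_arg_max_disjoint[OF P0] w_inner(3) that by blast

  have zero: "1 / (1 + sup_ratio_zero Pl Pu A \<B>) = (INF B\<in>blocks_zero Pl A \<B>. w B)"
    if ne: "blocks_zero Pl A \<B> \<noteq> {}"
  proof -
    have w: "1 / (1 + Pl (- A \<inter> B) / Pu (A \<inter> B)) = w B" and ge: "Pu A \<le> w B"
      if "B \<in> blocks_zero Pl A \<B>" for B
    proof -
      have B: "B \<in> \<B>" "?l B = 0" using that by (auto simp: blocks_zero_def blocks_pos_def)
      show "1 / (1 + Pl (- A \<inter> B) / Pu (A \<inter> B)) = w B"
        using one_minus_lower_conditional[OF vbm, of "- A" B] u[OF B(1)] u01[OF B(1)] B(2)
        by (simp add: w_def)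
      show "Pu A \<le> w B" using dil[OF B(1)] B(2) by (simp add: w_def)
    qed
    obtain B where "B \<in> \<B>" using ne by (auto simp: blocks_zero_def blocks_pos_def)
    \<comment> \<open>Strict dilation makes \<open>Pu A\<close> a positive uniform lower bound for
      the widths, which bounds the ratios.\<close>
    then have "0 < Pu A" using dil[of B] l01[of B] by linarith
    then show ?thesis
      unfolding sup_ratio_zero_def
      using ge by (subst INF_inverse_one_plus[OF ne, symmetric, where e = "Pu A"])
        (auto simp: w vbm_lower_nonneg[OF vbm] vbm_upper_nonneg[OF vbm])
  qed
  have one: "1 / (1 + sup_ratio_one Pl Pu A \<B>) = (INF B\<in>blocks_one Pl A \<B>. w B)"
    if ne: "blocks_one Pl A \<B> \<noteq> {}"
  proof -
    have w: "1 / (1 + Pl (A \<inter> B) / Pu (- A \<inter> B)) = w B" and ge: "1 - Pl A \<le> w B"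
      if "B \<in> blocks_one Pl A \<B>" for B
    proof -
      have B: "B \<in> \<B>" "?u B = 1" using that by (auto simp: blocks_one_def blocks_pos_def)
      show "1 / (1 + Pl (A \<inter> B) / Pu (- A \<inter> B)) = w B"
        using one_minus_lower_conditional[OF vbm, of A B] l[OF B(1)] l01[OF B(1)] B(2)
        by (simp add: w_def)
      show "1 - Pl A \<le> w B" using dil[OF B(1)] B(2) by (simp add: w_def)
    qed
    obtain B where "B \<in> \<B>" using ne by (auto simp: blocks_one_def blocks_pos_def)
    \<comment> \<open>Here \<open>1 - Pl A\<close> plays the part that \<open>Pu A\<close> plays for
      \<open>blocks_zero\<close>.\<close>
    then have "0 < 1 - Pl A" using dil[of B] u01[of B] by linarith
    then show ?thesis
      unfolding sup_ratio_one_def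
      using ge by (subst INF_inverse_one_plus[OF ne, symmetric, where e = "1 - Pl A"])
        (auto simp: w vbm_lower_nonneg[OF vbm] vbm_upper_nonneg[OF vbm])
  qed

  have w_pos: "0 \<le> w B" if "B \<in> \<B>" for B using dil[OF that] by (simp add: w_def)
  have INF_le: "(INF B\<in>\<C>. w B) \<le> w B" if "B \<in> \<C>" "\<C> \<subseteq> \<B>" for \<C> B
    using that w_pos by (intro cINF_lower bdd_belowI[of _ 0]) auto
  have sub: "blocks_zero Pl A \<B> \<subseteq> \<B>" "blocks_one Pl A \<B> \<subseteq> \<B>"
    by (auto simp: blocks_zero_def blocks_one_def blocks_pos_def)

  have "dilation_extent Pl Pu A \<B> = Pl A - Pu A + Min ({1}
      \<union> (if blocks_inner Pl A \<B> = {} then {} else {?u Bs - ?l Bs})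
      \<union> (if blocks_zero Pl A \<B> = {} then {} else {1 / (1 + sup_ratio_zero Pl Pu A \<B>)})
      \<union> (if blocks_one Pl A \<B> = {} then {} else {1 / (1 + sup_ratio_one Pl Pu A \<B>)}))"
    (is "_ = _ + Min ?M")
    if Bs: "blocks_inner Pl A \<B> \<noteq> {} \<longrightarrow> is_arg_max P\<^sub>0 (\<lambda>B. B \<in> blocks_inner Pl A \<B>) Bs" for Bs
    unfolding dilation_extent_def
  proof (rule cInf_eq_non_empty)
    have fin: "finite ?M" and ne: "?M \<noteq> {}" by auto
    have "\<B> \<noteq> {}" using partition by (auto simp: partition_on_def)
    then show "(\<lambda>B. ?u B - ?l B - (Pu A - Pl A)) ` \<B> \<noteq> {}" by simp
    \<comment> \<open>First half: \<open>Min ?M\<close> lies below every width, since each block has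
      its own term of \<open>?M\<close> below it.\<close>
    have "\<exists>m\<in>?M. m \<le> w B" if B: "B \<in> \<B>" for B
    proof -
      have nonneg: "0 \<le> Pl (A \<inter> B)" "0 \<le> Pl (- A \<inter> B)" by (rule vbm_lower_nonneg[OF vbm])+
      have mono: "Pl (A \<inter> B) \<le> Pl B" "Pl (- A \<inter> B) \<le> Pl B"
        by (auto intro: vbm_lower_mono[OF vbm])
      \<comment> \<open>Blocks with \<open>Pl B = 0\<close> fall into the first case by
        monotonicity; the other three force \<open>0 < Pl B\<close> and match the three classes of
        blocks.\<close>
      consider "Pl (A \<inter> B) = 0" "Pl (- A \<inter> B) = 0" | "0 < Pl (A \<inter> B)" "0 < Pl (- A \<inter> B)"
        | "Pl (A \<inter> B) = 0" "0 < Pl (- A \<inter> B)" | "0 < Pl (A \<inter> B)" "Pl (- A \<inter> B) = 0"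
        using nonneg by linarith
      then show ?thesis
      proof cases
        case 1
        then have "?l B = 0" "?u B = 1"
          using l_pos[OF B] u_less_1[OF B] l01[OF B] u01[OF B] by linarith+
        then show ?thesis by (auto simp: w_def)
      next
        case 2
        then have I: "B \<in> blocks_inner Pl A \<B>"
          using B mono l_pos[OF B] u_less_1[OF B] l01[OF B] u01[OF B]
          by (auto simp: blocks_inner_def blocks_pos_def)
        then have Bs: "Bs \<in> blocks_inner Pl A \<B>" "P\<^sub>0 B \<le> P\<^sub>0 Bs"
          using Bs by (auto simp: is_arg_max_def not_less)
        \<comment> \<open>The numerator is \<open>(1 - (a + b)) + (- a)\<close>, a sum of
          nonnegative terms, so the width is decreasing in \<open>P\<^sub>0 B\<close>.\<close>
        have "0 \<le> 1 - b - 2 * a" and "0 < b" using vbm_parameters[OF vbm] by linarith+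
        then have "w Bs \<le> w B"
          using w_inner[OF I] w_inner[OF Bs(1)] Bs(2) by (simp add: divide_left_mono)
        then show ?thesis using I by (auto simp: w_def)
      next
        case 3
        then have Z: "B \<in> blocks_zero Pl A \<B>"
          using B mono l_pos[OF B] u_less_1[OF B] l01[OF B] u01[OF B]
          by (auto simp: blocks_zero_def blocks_pos_def)
        then have "1 / (1 + sup_ratio_zero Pl Pu A \<B>) \<in> ?M" by auto
        moreover have "1 / (1 + sup_ratio_zero Pl Pu A \<B>) \<le> w B"
          using zero INF_le[OF Z sub(1)] Z by (metis empty_iff)
        ultimately show ?thesis by blast
      next
        case 4
        then have O: "B \<in> blocks_one Pl A \<B>"
          using B mono l_pos[OF B] u_less_1[OF B] l01[OF B] u01[OF B]
          by (auto simp: blocks_one_def blocks_pos_def)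
        then have "1 / (1 + sup_ratio_one Pl Pu A \<B>) \<in> ?M" by auto
        moreover have "1 / (1 + sup_ratio_one Pl Pu A \<B>) \<le> w B"
          using one INF_le[OF O sub(2)] O by (metis empty_iff)
        ultimately show ?thesis by blast
      qed
    qed
    then have "Min ?M \<le> w B" if "B \<in> \<B>" for B
      using that Min_le[OF fin] order_trans by blast
    then show "Pl A - Pu A + Min ?M \<le> y"
      if "y \<in> (\<lambda>B. ?u B - ?l B - (Pu A - Pl A)) ` \<B>" for y
      using that by (fastforce simp: w_def)
    fix y assume "\<And>x. x \<in> (\<lambda>B. ?u B - ?l B - (Pu A - Pl A)) ` \<B> \<Longrightarrow> y \<le> x"
    then have y: "y + (Pu A - Pl A) \<le> w B" if "B \<in> \<B>" for B
      using that by (fastforce simp: w_def)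
    \<comment> \<open>Second half: a lower bound of all widths is below each term of
      \<open>?M\<close>, as each is 1, a width, or an infimum of widths.\<close>
    have "y + (Pu A - Pl A) \<le> m" if m: "m \<in> ?M" for m
    proof -
      consider "m = 1" | "blocks_inner Pl A \<B> \<noteq> {}" "m = w Bs"
        | "blocks_zero Pl A \<B> \<noteq> {}" "m = (INF B\<in>blocks_zero Pl A \<B>. w B)"
        | "blocks_one Pl A \<B> \<noteq> {}" "m = (INF B\<in>blocks_one Pl A \<B>. w B)"
        using m by (auto simp: zero one w_def[of Bs] split: if_splits)
      then show ?thesis
      proof cases
        case 1
        \<comment> \<open>The value 1 need not be a width; it suffices that some block exists and
          that its width is at most 1.\<close>
        obtain B where "B \<in> \<B>" using \<open>\<B> \<noteq> {}\<close> by blast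
        then show ?thesis using y[of B] l01[of B] u01[of B] 1 by (simp add: w_def)
      next
        case 2
        then show ?thesis using Bs inner(1) y by (auto simp: is_arg_max_def)
      next
        case 3
        then show ?thesis using sub y by (auto intro!: cINF_greatest)
      next
        case 4
        then show ?thesis using sub y by (auto intro!: cINF_greatest)
      qed
    qed
    from this[OF Min_in[OF fin ne]] show "y \<le> Pl A - Pu A + Min ?M" by linarith
  qed
  with ex show ?thesis by blast
qed

end
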